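(* Let $\gamma>0$ and let $L:\mathbb Z^+\to\mathcal L(\mathcal B^\gamma,\mathcal X)$. Assume that there exists $m\in\mathbb Z^-$ such that $\sup_{n\in\mathbb Z^+}\|L(n)P_{[-\infty,m]}\|_{\mathcal B^\gamma\to\mathcal X}<\infty$. Then the following statements are equivalent: (i) The homogeneous system $x(n+1)=L(n)x_n$, $n\ge0$, is uniformly exponentially stable in $\mathcal B^\gamma$. (ii) The subdiagonal system $x(n+1)=L_{\mathrm{subd}}(n)x_n$, $n\ge0$, is uniformly exponentially stable in $\mathcal B^\gamma$. (iii) For any $\delta>0$ and any function $\widetilde L:\mathbb Z^+\to\mathcal L(\mathcal B^\delta,\mathcal X)$ such that $\widetilde L_{\mathrm{subd}}(n)=L_{\mathrm{subd}}(n)$ for all $n\in\mathbb Z^+$ and $\sup_{n\in\mathbb Z^+}\|\widetilde L(n)P_{[-\infty,l]}\|_{\mathcal B^\delta\to\mathcal X}<\infty$ for a certain $l\in\mathbb Z^-$, the homogeneous system $x(n+1)=\widetilde L(n)x_n$, $n\ge0$, is uniformly exponentially stable in $\mathcal B^\delta$. Moreover, the same equivalence of (i), (ii), (iii) holds if "uniformly exponentially stable" is replaced by "uniformly stable" in all three statements.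
   Context: $\mathbb Z^+$ and $\mathbb Z^-$ are the sets of nonnegative and nonpositive integers. $(\mathcal X,|\cdot|)$ is a (real or complex) Banach space. $\mathcal X^{\mathbb Z^-}$ is the vector space of all tuples $\varphi=(\varphi^{[m]})_{m\le 0}$ with $\varphi^{[m]}\in\mathcal X$. For $\gamma\in\mathbb R$, $\mathcal B^\gamma=\{\varphi\in\mathcal X^{\mathbb Z^-}: |\varphi|_{\mathcal B^\gamma}:=\sup_{m\le 0}|\varphi^{[m]}|e^{\gamma m}<\infty\}$ (the phase space). $\mathcal L(\mathcal B^\gamma,\mathcal X)$ is the space of bounded linear operators with operator norm $\|\cdot\|_{\mathcal B^\gamma\to\mathcal X}$. For $m_1\in\{-\infty\}\cup\mathbb Z^-$, $m_2\in\mathbb Z^-$, $m_1\le m_2$, $P_{[m_1,m_2]}:\mathcal X^{\mathbb Z^-}\to\mathcal X^{\mathbb Z^-}$ keeps the coordinates with index in $[m_1,m_2]$ and replaces all other coordinates by zero. For $L:\mathbb Z^+\to\mathcal L(\mathcal B^\gamma,\mathcal X)$, the operators $L_{\mathrm{subd}}(n):\mathcal X^{\mathbb Z^-}\to\mathcal X$ are defined by $L_{\mathrm{subd}}(0)\varphi=0$ and $L_{\mathrm{subd}}(n)\varphi=L(n)P_{[-n+1,0]}\varphi$ for $n\ge1$, $\varphi\in\mathcal X^{\mathbb Z^-}$ (and analogously $\widetilde L_{\mathrm{subd}}$ from $\widetilde L$). The system defined by $L_{\mathrm{subd}}$ is called the subdiagonal system associated with the system defined by $L$. For $x:\mathbb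 Z\to\mathcal X$ and $n\in\mathbb Z$, the prehistory $x_n\in\mathcal X^{\mathbb Z^-}$ is defined by $x_n^{[m]}=x(n+m)$, $m\le 0$. For $M:\mathbb Z^+\to\mathcal L(\mathcal B^\gamma,\mathcal X)$, $\tau\in\mathbb Z^+$, $\varphi\in\mathcal B^\gamma$, let $x_n(\tau,\varphi)$ be the prehistory at $n$ of the unique $x:\mathbb Z\to\mathcal X$ with $x_\tau=\varphi$ and $x(n+1)=M(n)x_n$ for all $n\ge\tau$. The homogeneous system $x(n+1)=M(n)x_n$ is uniformly exponentially stable in $\mathcal B^\gamma$ if there exist $K\ge1$, $\nu>0$ with $|x_n(\tau,\varphi)|_{\mathcal B^\gamma}\le Ke^{-\nu(n-\tau)}|\varphi|_{\mathcal B^\gamma}$ for all $n\ge\tau\ge0$, $\varphi\in\mathcal B^\gamma$; it is uniformly stable in $\mathcal B^\gamma$ if there exists $K\ge1$ with $|x_n(\tau,\varphi)|_{\mathcal B^\gamma}\le K|\varphi|_{\mathcal B^\gamma}$ for all $n\ge\tau\ge0$, $\varphi\in\mathcal B^\gamma$. *)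

theory Defs
  imports "HOL-Analysis.Analysis"
begin

text \<open>
  Banach spaces over \<open>'k\<close>.  Instantiating \<open>'k\<close> with \<^typ>\<open>real\<close> or \<^typ>\<open>complex\<close> gives the real
  and the complex Banach spaces; by the Gelfand--Mazur theorem these are, up to isomorphism, the
  only instances of \<^class>\<open>real_normed_field\<close>.  Completeness is part of the class \<^class>\<open>banach\<close>.
\<close>

locale banach_space_over = vector_space smul
  for smul :: "'k::real_normed_field \<Rightarrow> 'a::banach \<Rightarrow> 'a" +
  assumes norm_scale: "norm (smul c x) = norm c * norm x"
    and scale_of_real: "smul (of_real r) x = r *\<^sub>R x"

text \<open>
  A tuple \<open>\<phi>\<close> indexed by the nonpositive integers is a function on \<^typ>\<open>nat\<close>, where \<open>\<phi> k\<close> is the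
  coordinate with index \<open>-k\<close>.
\<close>

definition phase_space :: "real \<Rightarrow> (nat \<Rightarrow> 'a::real_normed_vector) set" where
  "phase_space \<gamma> = {\<phi>. bdd_above (range (\<lambda>k. norm (\<phi> k) * exp (\<gamma> * (- real k))))}"

definition phase_norm :: "real \<Rightarrow> (nat \<Rightarrow> 'a::real_normed_vector) \<Rightarrow> real" where
  "phase_norm \<gamma> \<phi> = (SUP k. norm (\<phi> k) * exp (\<gamma> * (- real k)))"

text \<open>
  Operators on the phase space are total functions of which only the values on \<^const>\<open>phase_space\<close>
  matter.
\<close>

definition bounded_operators ::
  "('k \<Rightarrow> 'a::real_normed_vector \<Rightarrow> 'a) \<Rightarrow> real \<Rightarrow> ((nat \<Rightarrow> 'a) \<Rightarrow> 'a) set" where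
  "bounded_operators smul \<gamma> = {T.
     (\<forall>\<phi>\<in>phase_space \<gamma>. \<forall>\<psi>\<in>phase_space \<gamma>. T (\<lambda>k. \<phi> k + \<psi> k) = T \<phi> + T \<psi>) \<and>
     (\<forall>c. \<forall>\<phi>\<in>phase_space \<gamma>. T (\<lambda>k. smul c (\<phi> k)) = smul c (T \<phi>)) \<and>
     (\<exists>C. \<forall>\<phi>\<in>phase_space \<gamma>. norm (T \<phi>) \<le> C * phase_norm \<gamma> \<phi>)}"

text \<open>As in \<^const>\<open>onorm\<close>, the quotient for \<open>\<phi> = 0\<close> is \<open>0\<close>.\<close>

definition operator_norm :: "real \<Rightarrow> ((nat \<Rightarrow> 'a::real_normed_vector) \<Rightarrow> 'a) \<Rightarrow> real" where
  "operator_norm \<gamma> T = (SUP \<phi>\<in>phase_space \<gamma>. norm (T \<phi>) / phase_norm \<gamma> \<phi>)"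

text \<open>
  \<open>I\<close> consists of the nonpositive integer indices themselves, not of their absolute values: the
  projection that keeps the coordinates from \<open>m\<^sub>1\<close> to \<open>m\<^sub>2\<close> is \<open>proj {m\<^sub>1..m\<^sub>2}\<close>, and \<open>proj {..m}\<close> is
  the case \<open>m\<^sub>1 = -\<infinity>\<close>.
\<close>

definition proj :: "int set \<Rightarrow> (nat \<Rightarrow> 'a::zero) \<Rightarrow> (nat \<Rightarrow> 'a)" where
  "proj I \<phi> = (\<lambda>k. if - int k \<in> I then \<phi> k else 0)"

definition subdiagonal ::
  "(nat \<Rightarrow> (nat \<Rightarrow> 'a::zero) \<Rightarrow> 'a) \<Rightarrow> nat \<Rightarrow> (nat \<Rightarrow> 'a) \<Rightarrow> 'a" where
  "subdiagonal L n \<phi> = (if n = 0 then 0 else L n (proj {- int n + 1..0} \<phi>))"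

definition prehistory :: "(int \<Rightarrow> 'a) \<Rightarrow> int \<Rightarrow> (nat \<Rightarrow> 'a)" where
  "prehistory x n = (\<lambda>k. x (n - int k))"

definition is_solution ::
  "(nat \<Rightarrow> (nat \<Rightarrow> 'a) \<Rightarrow> 'a) \<Rightarrow> nat \<Rightarrow> (nat \<Rightarrow> 'a) \<Rightarrow> (int \<Rightarrow> 'a) \<Rightarrow> bool" where
  "is_solution M \<tau> \<phi> x \<longleftrightarrow>
     prehistory x (int \<tau>) = \<phi> \<and>
     (\<forall>n\<ge>\<tau>. x (int n + 1) = M n (prehistory x (int n)))"

lemma ex1_solution: "\<exists>!x. is_solution M \<tau> \<phi> x"
proof (rule ex_ex1I)
  define y where "y = rec_nat (\<lambda>j. \<phi> (nat (int \<tau> - j)))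
    (\<lambda>i z. z (int (\<tau> + i) + 1 := M (\<tau> + i) (prehistory z (int (\<tau> + i)))))"
  have y0: "y 0 = (\<lambda>j. \<phi> (nat (int \<tau> - j)))"
    and yS: "y (Suc i) = (y i) (int (\<tau> + i) + 1 := M (\<tau> + i) (prehistory (y i) (int (\<tau> + i))))"
    for i by (simp_all add: y_def)
  define x where "x = (\<lambda>j. y (nat (j - int \<tau>)) j)"
  have stable: "y (i + d) j = y i j" if "j \<le> int (\<tau> + i)" for i d j
    using that by (induction d) (auto simp: yS)
  have x_y: "x j = y i j" if "j \<le> int (\<tau> + i)" for i j
    using that stable[of j "nat (j - int \<tau>)" "i - nat (j - int \<tau>)"]
    by (simp add: x_def)
  have "prehistory x (int \<tau>) = \<phi>"
    by (auto simp: prehistory_def x_def y0)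
  moreover have "x (int n + 1) = M n (prehistory x (int n))" if "n \<ge> \<tau>" for n
  proof -
    have n: "\<tau> + (n - \<tau>) = n" using that by simp
    have "x (int n + 1) = y (Suc (n - \<tau>)) (int n + 1)"
      by (rule x_y) (use that in simp)
    also have "\<dots> = M n (prehistory (y (n - \<tau>)) (int n))"
      by (simp only: yS n fun_upd_same)
    also have "prehistory (y (n - \<tau>)) (int n) = prehistory x (int n)"
      unfolding prehistory_def by (intro ext x_y[symmetric]) (simp add: n)
    finally show ?thesis .
  qed
  ultimately show "\<exists>x. is_solution M \<tau> \<phi> x"
    unfolding is_solution_def by blast
next
  fix x z
  assume x: "is_solution M \<tau> \<phi> x" and z: "is_solution M \<tau> \<phi> z"
  have eq: "prehistory x (int (\<tau> + i)) = prehistory z (int (\<tau> + i))" for i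
  proof (induction i)
    case 0
    then show ?case using x z by (simp add: is_solution_def)
  next
    case (Suc i)
    note IH = Suc
    have 1: "x (int (\<tau> + i) + 1) = z (int (\<tau> + i) + 1)"
      using x z IH unfolding is_solution_def by (metis le_add1)
    show ?case
    proof
      fix k
      show "prehistory x (int (\<tau> + Suc i)) k = prehistory z (int (\<tau> + Suc i)) k"
      proof (cases k)
        case 0
        then show ?thesis using 1 by (simp add: prehistory_def algebra_simps)
      next
        case (Suc l)
        then show ?thesis using fun_cong[OF IH, of l]
          by (simp add: prehistory_def algebra_simps)
      qed
    qed
  qed
  show "x = z"
  proof
    fix j
    have j: "int (\<tau> + nat \<bar>j\<bar>) - int (nat (int (\<tau> + nat \<bar>j\<bar>) - j)) = j"
      by simp
    show "x j = z j"
      using fun_cong[OF eq, of "nat \<bar>j\<bar>" "nat (int (\<tau> + nat \<bar>j\<bar>) - j)"]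
      unfolding prehistory_def j .
  qed
qed

definition solution ::
  "(nat \<Rightarrow> (nat \<Rightarrow> 'a) \<Rightarrow> 'a) \<Rightarrow> nat \<Rightarrow> (nat \<Rightarrow> 'a) \<Rightarrow> (int \<Rightarrow> 'a)" where
  "solution M \<tau> \<phi> = (THE x. is_solution M \<tau> \<phi> x)"

definition uniformly_exponentially_stable ::
  "real \<Rightarrow> (nat \<Rightarrow> (nat \<Rightarrow> 'a::real_normed_vector) \<Rightarrow> 'a) \<Rightarrow> bool" where
  "uniformly_exponentially_stable \<gamma> M \<longleftrightarrow>
     (\<exists>K\<ge>1. \<exists>\<nu>>0. \<forall>\<tau>. \<forall>n\<ge>\<tau>. \<forall>\<phi>\<in>phase_space \<gamma>.
        phase_norm \<gamma> (prehistory (solution M \<tau> \<phi>) (int n))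
          \<le> K * exp (- \<nu> * (real n - real \<tau>)) * phase_norm \<gamma> \<phi>)"

definition uniformly_stable ::
  "real \<Rightarrow> (nat \<Rightarrow> (nat \<Rightarrow> 'a::real_normed_vector) \<Rightarrow> 'a) \<Rightarrow> bool" where
  "uniformly_stable \<gamma> M \<longleftrightarrow>
     (\<exists>K\<ge>1. \<forall>\<tau>. \<forall>n\<ge>\<tau>. \<forall>\<phi>\<in>phase_space \<gamma>.
        phase_norm \<gamma> (prehistory (solution M \<tau> \<phi>) (int n)) \<le> K * phase_norm \<gamma> \<phi>)"

end

(*
  A solution of the system M started at time t is split into its restriction y to the times after t
  and the initial history.  The history is seen by y as a forcing term that decays like
  exp (- delta (n - t)), because delta > 0 and the operators M n turn out to be uniformly bounded.
  Since y vanishes at the times up to 0, it cannot distinguish M from any system L with the same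
  subdiagonal part, so variation of constants expresses y through the fundamental solutions of L,
  and the stability of L, possibly in another phase space, carries over to M.
*)
theory Submission
  imports Defs
begin

section \<open>Phase spaces and their norms in terms of coordinatewise bounds\<close>

lemma in_phase_space:
  assumes "\<And>k. norm (\<phi> k) \<le> C * exp (\<gamma> * real k)"
  shows "\<phi> \<in> phase_space \<gamma>"
proof -
  have "norm (\<phi> k) * exp (\<gamma> * (- real k)) \<le> C" for k
    using assms[of k] by (simp add: exp_minus field_simps)
  then show ?thesis
    unfolding phase_space_def by (auto intro!: bdd_aboveI)
qed

lemma phase_norm_le:
  assumes "\<And>k. norm (\<phi> k) \<le> C * exp (\<gamma> * real k)"
  shows "phase_norm \<gamma> \<phi> \<le> C"
proof -
  have "norm (\<phi> k) * exp (\<gamma> * (- real k)) \<le> C" for k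
    using assms[of k] by (simp add: exp_minus field_simps)
  then show ?thesis
    unfolding phase_norm_def by (intro cSUP_least) auto
qed

lemma norm_le_phase_norm:
  assumes "\<phi> \<in> phase_space \<gamma>"
  shows "norm (\<phi> k) \<le> phase_norm \<gamma> \<phi> * exp (\<gamma> * real k)"
proof -
  have "norm (\<phi> k) * exp (\<gamma> * (- real k)) \<le> phase_norm \<gamma> \<phi>"
    using assms unfolding phase_norm_def phase_space_def by (intro cSUP_upper) auto
  then show ?thesis by (simp add: exp_minus field_simps)
qed

lemma phase_norm_nonneg:
  assumes "\<phi> \<in> phase_space \<gamma>"
  shows "0 \<le> phase_norm \<gamma> \<phi>"
  using order_trans[OF norm_ge_zero norm_le_phase_norm[OF assms, of 0]] by simp

lemma zero_in_phase_space: "(\<lambda>k. 0) \<in> phase_space \<gamma>"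
  by (rule in_phase_space[of _ 0]) simp

lemma phase_space_add:
  assumes "\<phi> \<in> phase_space \<gamma>" and "\<psi> \<in> phase_space \<gamma>"
  shows "(\<lambda>k. \<phi> k + \<psi> k) \<in> phase_space \<gamma>"
proof (rule in_phase_space)
  fix k
  show "norm (\<phi> k + \<psi> k) \<le> (phase_norm \<gamma> \<phi> + phase_norm \<gamma> \<psi>) * exp (\<gamma> * real k)"
    using norm_triangle_ineq[of "\<phi> k" "\<psi> k"] norm_le_phase_norm[OF assms(1), of k]
      norm_le_phase_norm[OF assms(2), of k] by (simp add: algebra_simps)
qed

lemma phase_space_sum:
  assumes "finite S" and "\<And>s. s \<in> S \<Longrightarrow> \<phi> s \<in> phase_space \<gamma>"
  shows "(\<lambda>k. \<Sum>s\<in>S. \<phi> s k) \<in> phase_space \<gamma>"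
  using assms by (induction S rule: finite_induct)
    (auto simp: zero_in_phase_space intro: phase_space_add)

lemma restrict_in_phase_space:
  assumes "\<phi> \<in> phase_space \<gamma>"
  shows "(\<lambda>k. if P k then \<phi> k else 0) \<in> phase_space \<gamma>"
proof (rule in_phase_space)
  fix k
  show "norm (if P k then \<phi> k else 0) \<le> phase_norm \<gamma> \<phi> * exp (\<gamma> * real k)"
    using norm_le_phase_norm[OF assms, of k] phase_norm_nonneg[OF assms] by simp
qed

lemma phase_norm_restrict_le:
  assumes "\<phi> \<in> phase_space \<gamma>"
  shows "phase_norm \<gamma> (\<lambda>k. if P k then \<phi> k else 0) \<le> phase_norm \<gamma> \<phi>"
proof (rule phase_norm_le)
  fix k
  show "norm (if P k then \<phi> k else 0) \<le> phase_norm \<gamma> \<phi> * exp (\<gamma> * real k)"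
    using norm_le_phase_norm[OF assms, of k] phase_norm_nonneg[OF assms] by simp
qed

text \<open>Finitely many nonzero coordinates are bounded under any weight, so a truncated history
  can be passed from one phase space to another. The sum of the weighted norms is used in place of
  their maximum, which would make no sense for \<open>m = 0\<close>.\<close>

lemma truncate_in_phase_space: "(\<lambda>k. if k < (m::nat) then \<phi> k else 0) \<in> phase_space \<gamma>"
proof (rule in_phase_space)
  fix k
  have "norm (\<phi> k) * exp (- \<gamma> * real k) \<le> (\<Sum>i<m. norm (\<phi> i) * exp (- \<gamma> * real i))" if "k < m"
    using that by (intro member_le_sum[of k "{..<m}" "\<lambda>i. norm (\<phi> i) * exp (- \<gamma> * real i)"]) auto
  then show "norm (if k < m then \<phi> k else 0)
      \<le> (\<Sum>i<m. norm (\<phi> i) * exp (- \<gamma> * real i)) * exp (\<gamma> * real k)"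
    by (auto simp: exp_minus field_simps intro!: mult_nonneg_nonneg sum_nonneg)
qed

lemma phase_norm_spike: "phase_norm \<gamma> (\<lambda>k. if k = 0 then v else 0) \<le> norm v"
  by (rule phase_norm_le) simp

section \<open>Solutions and their prehistories\<close>

lemma solution_is_solution: "is_solution M \<tau> \<phi> (solution M \<tau> \<phi>)"
  unfolding solution_def by (rule theI'[OF ex1_solution])

lemma prehistory_solution_initial: "prehistory (solution M \<tau> \<phi>) (int \<tau>) = \<phi>"
  using solution_is_solution[of M \<tau> \<phi>] by (simp add: is_solution_def)

lemma solution_initial:
  assumes "j \<le> int \<tau>"
  shows "solution M \<tau> \<phi> j = \<phi> (nat (int \<tau> - j))"
  using fun_cong[OF prehistory_solution_initial, of M \<tau> \<phi> "nat (int \<tau> - j)"] assms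
  by (simp add: prehistory_def)

lemma solution_step:
  assumes "\<tau> \<le> n"
  shows "solution M \<tau> \<phi> (int n + 1) = M n (prehistory (solution M \<tau> \<phi>) (int n))"
  using solution_is_solution[of M \<tau> \<phi>] assms by (simp add: is_solution_def)

lemma prehistory_0: "prehistory x n 0 = x n"
  by (simp add: prehistory_def)

lemma prehistory_Suc: "prehistory x (int (Suc n)) (Suc k) = prehistory x (int n) k"
  by (simp add: prehistory_def)

text \<open>One step shifts the history by one coordinate and puts a new value in front. For
  \<open>\<gamma> > 0\<close> the weights decrease with \<open>k\<close>, so the shift does not
  enlarge the norm.\<close>

lemma prehistory_Suc_in_phase_space:
  assumes "0 < \<gamma>" and "prehistory x (int n) \<in> phase_space \<gamma>"
  shows "prehistory x (int (Suc n)) \<in> phase_space \<gamma>"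
proof (rule in_phase_space)
  fix k
  let ?C = "max (norm (x (int (Suc n)))) (phase_norm \<gamma> (prehistory x (int n)))"
  show "norm (prehistory x (int (Suc n)) k) \<le> ?C * exp (\<gamma> * real k)"
  proof (cases k)
    case 0
    then show ?thesis by (simp add: prehistory_0)
  next
    case (Suc i)
    have "norm (prehistory x (int n) i) \<le> phase_norm \<gamma> (prehistory x (int n)) * exp (\<gamma> * real i)"
      by (rule norm_le_phase_norm[OF assms(2)])
    also have "\<dots> \<le> ?C * exp (\<gamma> * real k)"
      using assms(1) Suc by (intro mult_mono) (auto simp: le_max_iff_disj)
    finally show ?thesis by (simp add: Suc prehistory_Suc del: of_nat_Suc)
  qed
qed

lemma prehistory_solution_in_phase_space:
  assumes "0 < \<gamma>" and "\<phi> \<in> phase_space \<gamma>" and "\<tau> \<le> n"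
  shows "prehistory (solution M \<tau> \<phi>) (int n) \<in> phase_space \<gamma>"
  using assms(3)
proof (induction n rule: dec_induct)
  case base
  then show ?case using assms(2) by (simp add: prehistory_solution_initial)
next
  case (step n)
  then show ?case using prehistory_Suc_in_phase_space[OF assms(1)] by blast
qed

section \<open>Rates of stability and the abstract class of systems\<close>

text \<open>The rate is a parameter while \<open>K\<close> stays existential. Rate 0 then gives
  uniform stability and some positive rate gives uniform exponential stability, so that one estimate
  serves both.\<close>

definition stable_with_rate ::
  "real \<Rightarrow> real \<Rightarrow> (nat \<Rightarrow> (nat \<Rightarrow> 'a::real_normed_vector) \<Rightarrow> 'a) \<Rightarrow> bool" where
  "stable_with_rate \<nu> \<gamma> M \<longleftrightarrow>
     (\<exists>K\<ge>1. \<forall>\<tau>. \<forall>n\<ge>\<tau>. \<forall>\<phi>\<in>phase_space \<gamma>.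
        phase_norm \<gamma> (prehistory (solution M \<tau> \<phi>) (int n))
          \<le> K * exp (- \<nu> * (real n - real \<tau>)) * phase_norm \<gamma> \<phi>)"

lemma uniformly_stable_iff_rate: "uniformly_stable \<gamma> M \<longleftrightarrow> stable_with_rate 0 \<gamma> M"
  unfolding uniformly_stable_def stable_with_rate_def by simp

lemma uniformly_exponentially_stable_iff_rate:
  "uniformly_exponentially_stable \<gamma> M \<longleftrightarrow> (\<exists>\<nu>>0. stable_with_rate \<nu> \<gamma> M)"
  unfolding uniformly_exponentially_stable_def stable_with_rate_def by blast

text \<open>Collects what the estimates use, in a form that fits \<open>L\<close>, its subdiagonal
  part and any \<open>L'\<close> alike. In \<open>tail_bounded\<close>, vectors whose
  \<open>m\<close> newest coordinates vanish stand for the range of the projection onto the old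
  coordinates.\<close>

locale fading_system =
  fixes \<gamma> :: real and M :: "nat \<Rightarrow> (nat \<Rightarrow> 'a::real_normed_vector) \<Rightarrow> 'a"
  assumes pos: "0 < \<gamma>"
    and add: "\<phi> \<in> phase_space \<gamma> \<Longrightarrow> \<psi> \<in> phase_space \<gamma> \<Longrightarrow> M n (\<lambda>k. \<phi> k + \<psi> k) = M n \<phi> + M n \<psi>"
    and bounded: "\<exists>C. \<forall>\<phi>\<in>phase_space \<gamma>. norm (M n \<phi>) \<le> C * phase_norm \<gamma> \<phi>"
    and tail_bounded: "\<exists>m C. \<forall>n. \<forall>\<phi>\<in>phase_space \<gamma>.
      (\<forall>k<m. \<phi> k = 0) \<longrightarrow> norm (M n \<phi>) \<le> C * phase_norm \<gamma> \<phi>"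
begin

lemma zero: "M n (\<lambda>k. 0) = 0"
  using add[OF zero_in_phase_space zero_in_phase_space, of n] by simp

lemma sum:
  assumes "finite S" and "\<And>s. s \<in> S \<Longrightarrow> \<phi> s \<in> phase_space \<gamma>"
  shows "M n (\<lambda>k. \<Sum>s\<in>S. \<phi> s k) = (\<Sum>s\<in>S. M n (\<phi> s))"
  using assms
proof (induction S rule: finite_induct)
  case empty
  then show ?case by (simp add: zero)
next
  case (insert s S)
  then show ?case
    using add[of "\<phi> s" "\<lambda>k. \<Sum>s\<in>S. \<phi> s k" n] phase_space_sum[of S \<phi> \<gamma>] by simp
qed

lemma split:
  assumes "\<phi> \<in> phase_space \<gamma>"
  shows "M n \<phi> = M n (\<lambda>k. if P k then \<phi> k else 0) + M n (\<lambda>k. if \<not> P k then \<phi> k else 0)"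
proof -
  have "(\<lambda>k. (if P k then \<phi> k else 0) + (if \<not> P k then \<phi> k else 0)) = \<phi>"
    by auto
  then show ?thesis
    using add[of "\<lambda>k. if P k then \<phi> k else 0" "\<lambda>k. if \<not> P k then \<phi> k else 0" n]
      restrict_in_phase_space[OF assms] by simp
qed

text \<open>Started at time \<open>n\<close> from \<open>\<phi>\<close>, the solution has
  \<open>M n \<phi>\<close> as its newest coordinate one step later. The stability estimate over
  this single step therefore bounds the operator, and \<open>K\<close> itself is a uniform bound
  because \<open>exp (- \<nu>)\<close> is at most 1.\<close>

lemma stable_imp_uniformly_bounded:
  assumes "stable_with_rate \<nu> \<gamma> M" and "0 \<le> \<nu>"
  shows "\<exists>D\<ge>0. \<forall>n. \<forall>\<phi>\<in>phase_space \<gamma>. norm (M n \<phi>) \<le> D * phase_norm \<gamma> \<phi>"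
proof -
  obtain K where K: "1 \<le> K" and stable: "\<And>\<tau> n \<phi>. \<tau> \<le> n \<Longrightarrow> \<phi> \<in> phase_space \<gamma> \<Longrightarrow>
      phase_norm \<gamma> (prehistory (solution M \<tau> \<phi>) (int n))
        \<le> K * exp (- \<nu> * (real n - real \<tau>)) * phase_norm \<gamma> \<phi>"
    using assms(1) unfolding stable_with_rate_def by blast
  have "norm (M n \<phi>) \<le> K * phase_norm \<gamma> \<phi>" if \<phi>: "\<phi> \<in> phase_space \<gamma>" for n \<phi>
  proof -
    let ?x = "solution M n \<phi>"
    have "M n \<phi> = prehistory ?x (int (Suc n)) 0"
      using solution_step[of n n M \<phi>]
      by (simp add: prehistory_solution_initial prehistory_0 add.commute)
    then have "norm (M n \<phi>) \<le> phase_norm \<gamma> (prehistory ?x (int (Suc n)))"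
      using norm_le_phase_norm[OF prehistory_solution_in_phase_space[OF pos \<phi>, of n "Suc n" M], of 0]
      by (simp del: of_nat_Suc)
    also have "\<dots> \<le> K * exp (- \<nu> * (real (Suc n) - real n)) * phase_norm \<gamma> \<phi>"
      by (rule stable) (use \<phi> in auto)
    also have "\<dots> \<le> K * 1 * phase_norm \<gamma> \<phi>"
      using K assms(2) phase_norm_nonneg[OF \<phi>] by (intro mult_mono) auto
    finally show ?thesis by simp
  qed
  then show ?thesis using K by (intro exI[of _ K]) auto
qed

end

section \<open>Transfer of stability between systems with equal subdiagonal part\<close>

text \<open>
  The tail bound on \<open>M\<close> says nothing about the most recent \<open>m\<close> coordinates.  If \<open>n \<ge> m\<close>, these are
  seen by \<open>M n\<close> only through \<open>L n\<close>; the finitely many other \<open>n\<close> are bounded one by one.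
\<close>

lemma uniformly_bounded_transfer:
  fixes M :: "nat \<Rightarrow> (nat \<Rightarrow> 'a::real_normed_vector) \<Rightarrow> 'a"
  assumes "fading_system \<delta> M"
    and L: "\<And>n \<phi>. \<phi> \<in> phase_space \<gamma> \<Longrightarrow> norm (L n \<phi>) \<le> D * phase_norm \<gamma> \<phi>" and "0 \<le> D" "0 < \<gamma>"
    and agree: "\<And>n \<phi>. (\<And>k. n \<le> k \<Longrightarrow> \<phi> k = 0) \<Longrightarrow> M n \<phi> = L n \<phi>"
  shows "\<exists>E\<ge>0. \<forall>n. \<forall>\<phi>\<in>phase_space \<delta>. norm (M n \<phi>) \<le> E * phase_norm \<delta> \<phi>"
proof -
  interpret M: fading_system \<delta> M by fact
  obtain m C where tail: "\<And>n \<phi>. \<phi> \<in> phase_space \<delta> \<Longrightarrow> (\<And>k. k < m \<Longrightarrow> \<phi> k = 0) \<Longrightarrow>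
      norm (M n \<phi>) \<le> C * phase_norm \<delta> \<phi>"
    using M.tail_bounded by metis
  obtain B where B: "\<And>n \<phi>. \<phi> \<in> phase_space \<delta> \<Longrightarrow> norm (M n \<phi>) \<le> B n * phase_norm \<delta> \<phi>"
    using M.bounded by metis
  \<comment> \<open>The sum covers the times \<open>n < m\<close>. For later times, the
    \<open>m\<close> newest coordinates cost \<open>D * exp (\<delta> * real m)\<close> and the
    remaining ones cost \<open>\<bar>C\<bar>\<close>.\<close>
  define E where "E = (\<Sum>n<m. \<bar>B n\<bar>) + (D * exp (\<delta> * real m) + \<bar>C\<bar>)"
  have nonneg: "0 \<le> (\<Sum>n<m. \<bar>B n\<bar>)" "0 \<le> D * exp (\<delta> * real m) + \<bar>C\<bar>"
    using \<open>0 \<le> D\<close> by (auto intro: sum_nonneg)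
  have "norm (M n \<phi>) \<le> E * phase_norm \<delta> \<phi>" if \<phi>: "\<phi> \<in> phase_space \<delta>" for n \<phi>
  proof (cases "n < m")
    case True
    then have "\<bar>B n\<bar> \<le> (\<Sum>n<m. \<bar>B n\<bar>)"
      by (intro member_le_sum[of n "{..<m}" "\<lambda>n. \<bar>B n\<bar>"]) auto
    then have "B n \<le> E" using nonneg unfolding E_def by linarith
    then show ?thesis
      using B[OF \<phi>, of n] phase_norm_nonneg[OF \<phi>] by (meson mult_right_mono order_trans)
  next
    case False
    let ?a = "\<lambda>k. if k < m then \<phi> k else 0"
    let ?b = "\<lambda>k. if \<not> k < m then \<phi> k else 0"
    \<comment> \<open>The change of weight: for \<open>k < m\<close> the factor
      \<open>exp (\<delta> * real k)\<close> is at most \<open>exp (\<delta> * real m)\<close>,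
      while \<open>exp (\<gamma> * real k)\<close> is at least 1.\<close>
    have "phase_norm \<gamma> ?a \<le> exp (\<delta> * real m) * phase_norm \<delta> \<phi>"
    proof (rule phase_norm_le)
      fix k
      have "norm (\<phi> k) \<le> exp (\<delta> * real m) * phase_norm \<delta> \<phi> * exp (\<gamma> * real k)" if "k < m"
      proof -
        have "norm (\<phi> k) \<le> phase_norm \<delta> \<phi> * exp (\<delta> * real k)"
          by (rule norm_le_phase_norm[OF \<phi>])
        also have "\<dots> \<le> phase_norm \<delta> \<phi> * exp (\<delta> * real m)"
          using that M.pos phase_norm_nonneg[OF \<phi>] by (intro mult_left_mono) auto
        also have "\<dots> \<le> phase_norm \<delta> \<phi> * exp (\<delta> * real m) * exp (\<gamma> * real k)"
          using mult_left_mono[of 1 "exp (\<gamma> * real k)" "phase_norm \<delta> \<phi> * exp (\<delta> * real m)"]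
            \<open>0 < \<gamma>\<close> phase_norm_nonneg[OF \<phi>] by simp
        finally show ?thesis by (simp add: mult.commute)
      qed
      then show "norm (?a k) \<le> exp (\<delta> * real m) * phase_norm \<delta> \<phi> * exp (\<gamma> * real k)"
        using phase_norm_nonneg[OF \<phi>] by simp
    qed
    then have "D * phase_norm \<gamma> ?a \<le> D * exp (\<delta> * real m) * phase_norm \<delta> \<phi>"
      using \<open>0 \<le> D\<close> by (simp add: mult_left_mono mult.assoc)
    \<comment> \<open>Since \<open>m \<le> n\<close>, the vector \<open>?a\<close> vanishes from
      coordinate \<open>n\<close> on, so \<open>M n\<close> and \<open>L n\<close> agree on
      it.\<close>
    moreover have "norm (M n ?a) \<le> D * phase_norm \<gamma> ?a"
      using L[OF truncate_in_phase_space[of m \<phi> \<gamma>], of n] agree[of n ?a] False by simp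
    moreover have "norm (M n ?b) \<le> \<bar>C\<bar> * phase_norm \<delta> \<phi>"
    proof -
      have b: "?b \<in> phase_space \<delta>" by (rule restrict_in_phase_space[OF \<phi>])
      have "norm (M n ?b) \<le> C * phase_norm \<delta> ?b" by (rule tail[OF b]) simp
      also have "\<dots> \<le> \<bar>C\<bar> * phase_norm \<delta> \<phi>"
        using phase_norm_restrict_le[OF \<phi>] phase_norm_nonneg[OF b] by (intro mult_mono) auto
      finally show ?thesis .
    qed
    moreover have "norm (M n \<phi>) \<le> norm (M n ?a) + norm (M n ?b)"
      using M.split[OF \<phi>, of n "\<lambda>k. k < m"] norm_triangle_ineq by metis
    ultimately have "norm (M n \<phi>) \<le> (D * exp (\<delta> * real m) + \<bar>C\<bar>) * phase_norm \<delta> \<phi>"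
      by (simp add: algebra_simps)
    also have "\<dots> \<le> E * phase_norm \<delta> \<phi>"
      using nonneg phase_norm_nonneg[OF \<phi>] by (intro mult_right_mono) (auto simp: E_def)
    finally show ?thesis .
  qed
  moreover have "0 \<le> E" using nonneg by (simp add: E_def)
  ultimately show ?thesis by blast
qed

text \<open>Superposition: the forcing \<open>f s\<close> first appears in \<open>y\<close> at time
  \<open>s + 1\<close>, and from then on it evolves like a solution started at \<open>Suc s\<close>
  with \<open>f s\<close> as its only nonzero coordinate. Whole prehistories are compared, not just
  values, because the induction has to apply \<open>M n\<close> to them.\<close>

lemma (in fading_system) variation_of_constants:
  assumes initial: "\<And>j. j \<le> int \<tau> \<Longrightarrow> y j = 0"
    and step: "\<And>n. \<tau> \<le> n \<Longrightarrow> y (int n + 1) = M n (prehistory y (int n)) + f n"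
    and "\<tau> \<le> n"
  shows "prehistory y (int n) = (\<lambda>k. \<Sum>s=\<tau>..<n.
    prehistory (solution M (Suc s) (\<lambda>i. if i = 0 then f s else 0)) (int n) k)"
  using assms(3)
proof (induction n rule: dec_induct)
  case base
  then show ?case by (auto simp: prehistory_def initial)
next
  case (step n)
  define X where "X s = solution M (Suc s) (\<lambda>i. if i = 0 then f s else 0)" for s
  have spike: "(\<lambda>i. if i = 0 then v else 0) \<in> phase_space \<gamma>" for v :: 'a
    using truncate_in_phase_space[of 1 "\<lambda>_. v" \<gamma>] by simp
  have X_space: "prehistory (X s) (int n) \<in> phase_space \<gamma>" if "s < n" for s
    unfolding X_def using that by (intro prehistory_solution_in_phase_space[OF pos spike]) simp
  \<comment> \<open>The summand that is new at time \<open>n + 1\<close> is still in its initial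
    history: it contributes \<open>f n\<close> to coordinate 0 and nothing to the older
    coordinates.\<close>
  have X_n: "X n j = (if j = int n + 1 then f n else 0)" if "j \<le> int n + 1" for j
    using that by (simp add: X_def solution_initial)
  have IH: "prehistory y (int n) = (\<lambda>k. \<Sum>s=\<tau>..<n. prehistory (X s) (int n) k)"
    using step.IH by (simp add: X_def)
  have "prehistory y (int (Suc n)) k = (\<Sum>s=\<tau>..<Suc n. prehistory (X s) (int (Suc n)) k)" for k
  proof (cases k)
    case 0
    have "y (int n + 1) = (\<Sum>s=\<tau>..<n. M n (prehistory (X s) (int n))) + f n"
      unfolding assms(2)[OF step.hyps(1)] IH by (subst sum) (auto intro: X_space)
    also have "(\<Sum>s=\<tau>..<n. M n (prehistory (X s) (int n))) = (\<Sum>s=\<tau>..<n. X s (int n + 1))"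
      by (intro sum.cong refl) (simp add: X_def solution_step)
    also have "f n = X n (int n + 1)" by (simp add: X_n)
    finally show ?thesis
      using 0 step.hyps(1) by (simp add: prehistory_0 add.commute)
  next
    case (Suc i)
    have "prehistory (X n) (int (Suc n)) k = 0"
      by (simp add: prehistory_def X_n Suc)
    then show ?thesis
      using step.hyps(1) fun_cong[OF IH, of i] by (simp add: Suc prehistory_Suc del: of_nat_Suc)
  qed
  then show ?case by (auto simp: X_def)
qed

text \<open>
  The other half of the decay \<open>\<delta>\<close> of the forcing term makes the variation of constants sum a
  geometric one, so that the rate \<open>\<nu> = 0\<close> is preserved.
\<close>

lemma stable_with_rate_transfer:
  fixes M L :: "nat \<Rightarrow> (nat \<Rightarrow> 'a::real_normed_vector) \<Rightarrow> 'a"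
  assumes "fading_system \<delta> M" and "fading_system \<gamma> L"
    and agree: "\<And>n \<phi>. (\<And>k. n \<le> k \<Longrightarrow> \<phi> k = 0) \<Longrightarrow> M n \<phi> = L n \<phi>"
    and L_stable: "stable_with_rate \<nu> \<gamma> L" and "0 \<le> \<nu>"
  shows "stable_with_rate (min \<nu> (\<delta> / 2)) \<delta> M"
proof -
  interpret M: fading_system \<delta> M by fact
  interpret L: fading_system \<gamma> L by fact
  \<comment> \<open>The new rate can exceed neither the rate of \<open>L\<close> nor the half of the
    forcing decay that is spent on it.\<close>
  define \<mu> where "\<mu> = min \<nu> (\<delta> / 2)"
  have \<mu>: "0 \<le> \<mu>" "\<mu> \<le> \<nu>" "\<mu> \<le> \<delta> / 2" "\<mu> \<le> \<delta>"
    using \<open>0 \<le> \<nu>\<close> M.pos by (auto simp: \<mu>_def)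
  obtain K where K: "1 \<le> K" and stable: "\<And>\<tau> n \<phi>. \<tau> \<le> n \<Longrightarrow> \<phi> \<in> phase_space \<gamma> \<Longrightarrow>
      phase_norm \<gamma> (prehistory (solution L \<tau> \<phi>) (int n))
        \<le> K * exp (- \<nu> * (real n - real \<tau>)) * phase_norm \<gamma> \<phi>"
    using L_stable unfolding stable_with_rate_def by blast
  obtain D where "0 \<le> D" and D: "\<And>n \<phi>. \<phi> \<in> phase_space \<gamma> \<Longrightarrow> norm (L n \<phi>) \<le> D * phase_norm \<gamma> \<phi>"
    using L.stable_imp_uniformly_bounded[OF L_stable \<open>0 \<le> \<nu>\<close>] by blast
  obtain E where "0 \<le> E" and E: "\<And>n \<phi>. \<phi> \<in> phase_space \<delta> \<Longrightarrow> norm (M n \<phi>) \<le> E * phase_norm \<delta> \<phi>"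
    using uniformly_bounded_transfer[OF assms(1) D \<open>0 \<le> D\<close> L.pos agree] by blast
  \<comment> \<open>The unspent half of the forcing decay is the ratio of a geometric
    series.\<close>
  define q where "q = exp (- \<delta> / 2)"
  have q: "0 < q" "q < 1" using M.pos by (auto simp: q_def)
  \<comment> \<open>\<open>K\<close> comes from the stability of \<open>L\<close>, \<open>E\<close>
    from the size of the forcing, \<open>exp \<mu>\<close> from the delay of one step before the
    forcing enters, and the denominator from the geometric series.\<close>
  define C where "C = K * E * exp \<mu> / (1 - q)"
  have "0 \<le> C" using K \<open>0 \<le> E\<close> q by (simp add: C_def)
  have bound: "phase_norm \<delta> (prehistory (solution M \<tau> \<phi>) (int n))
      \<le> (1 + C) * exp (- \<mu> * (real n - real \<tau>)) * phase_norm \<delta> \<phi>"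
    if "\<tau> \<le> n" and \<phi>: "\<phi> \<in> phase_space \<delta>" for \<tau> n \<phi>
  proof -
    define x where "x = solution M \<tau> \<phi>"
    define N where "N = phase_norm \<delta> \<phi>"
    have "0 \<le> N" using phase_norm_nonneg[OF \<phi>] by (simp add: N_def)
    \<comment> \<open>\<open>y\<close> is the part of \<open>x\<close> after time
      \<open>\<tau>\<close>, \<open>h n\<close> is the complementary part of the prehistory at
      \<open>n\<close>, and \<open>f n\<close> is its effect through \<open>M n\<close>.\<close>
    define y where "y j = (if j > int \<tau> then x j else 0)" for j
    define h where "h n = (\<lambda>k. if \<not> int n - int k > int \<tau> then x (int n - int k) else 0)" for n
    define f where "f n = M n (h n)" for n
    have x_initial: "norm (x j) \<le> N * exp (\<delta> * (real \<tau> - real_of_int j))" if "j \<le> int \<tau>" for j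
      using norm_le_phase_norm[OF \<phi>, of "nat (int \<tau> - j)"] that
      by (simp add: x_def solution_initial N_def)
    \<comment> \<open>By time \<open>n\<close> the initial history has moved back by
      \<open>n - \<tau>\<close> coordinates, and the weight turns this into the factor
      \<open>exp (- \<delta> * (real n - real \<tau>))\<close>.\<close>
    have h: "norm (h n k) \<le> N * exp (- \<delta> * (real n - real \<tau>)) * exp (\<delta> * real k)" for n k
    proof (cases "int n - int k > int \<tau>")
      case True
      then show ?thesis using \<open>0 \<le> N\<close> by (simp add: h_def)
    next
      case False
      then have "norm (h n k) \<le> N * exp (\<delta> * (real \<tau> - real_of_int (int n - int k)))"
        using x_initial[of "int n - int k"] by (simp add: h_def)
      also have "\<dots> = N * exp (- \<delta> * (real n - real \<tau>)) * exp (\<delta> * real k)"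
        by (simp add: mult.assoc flip: exp_add) (simp add: algebra_simps)
      finally show ?thesis .
    qed
    have f: "norm (f n) \<le> E * (N * exp (- \<delta> * (real n - real \<tau>)))" for n
    proof -
      have "norm (f n) \<le> E * phase_norm \<delta> (h n)"
        unfolding f_def by (rule E) (rule in_phase_space[OF h])
      also have "\<dots> \<le> E * (N * exp (- \<delta> * (real n - real \<tau>)))"
        by (intro mult_left_mono phase_norm_le[OF h] \<open>0 \<le> E\<close>)
      finally show ?thesis .
    qed
    have y_step: "y (int n + 1) = L n (prehistory y (int n)) + f n" if "\<tau> \<le> n" for n
    proof -
      have "prehistory x (int n) \<in> phase_space \<delta>"
        unfolding x_def by (rule prehistory_solution_in_phase_space[OF M.pos \<phi> that])
      moreover have "(\<lambda>k. if int n - int k > int \<tau> then prehistory x (int n) k else 0)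
          = prehistory y (int n)"
        by (simp add: prehistory_def y_def fun_eq_iff)
      moreover have "(\<lambda>k. if \<not> int n - int k > int \<tau> then prehistory x (int n) k else 0) = h n"
        by (simp add: prehistory_def h_def fun_eq_iff)
      ultimately have "M n (prehistory x (int n)) = M n (prehistory y (int n)) + f n"
        using M.split[of "prehistory x (int n)" n "\<lambda>k. int n - int k > int \<tau>"]
        by (simp only: f_def)
      \<comment> \<open>Coordinates \<open>k \<ge> n\<close> of this prehistory belong to times
        \<open>n - k \<le> 0 \<le> \<tau>\<close>, where \<open>y\<close> vanishes, so
        \<open>M\<close> may be replaced by \<open>L\<close>.\<close>
      moreover have "M n (prehistory y (int n)) = L n (prehistory y (int n))"
        by (rule agree) (simp add: prehistory_def y_def)
      moreover have "y (int n + 1) = M n (prehistory x (int n))"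
        using that by (simp add: y_def x_def solution_step)
      ultimately show ?thesis by simp
    qed
    have y_bound: "norm (y (int n)) \<le> C * exp (- \<mu> * (real n - real \<tau>)) * N" if "\<tau> \<le> n" for n
    proof -
      let ?e = "\<lambda>s. \<lambda>i::nat. if i = 0 then f s else 0"
      let ?X = "\<lambda>s. prehistory (solution L (Suc s) (?e s)) (int n)"
      have summand: "norm (?X s 0) \<le> K * E * N * exp \<mu> * exp (- \<mu> * (real n - real \<tau>)) * q ^ (s - \<tau>)"
        if s: "s \<in> {\<tau>..<n}" for s
      proof -
        have e: "?e s \<in> phase_space \<gamma>"
          using truncate_in_phase_space[of 1 "\<lambda>_. f s" \<gamma>] by simp
        have "norm (?X s 0) \<le> phase_norm \<gamma> (?X s)"
          using norm_le_phase_norm[OF prehistory_solution_in_phase_space[OF L.pos e, of "Suc s" n L], of 0]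
            s by simp
        also have "\<dots> \<le> K * exp (- \<nu> * (real n - real (Suc s))) * phase_norm \<gamma> (?e s)"
          using s by (intro stable e) simp
        also have "\<dots> \<le> K * exp (- \<mu> * (real n - real (Suc s))) * (E * (N * exp (- \<delta> * (real s - real \<tau>))))"
        proof (intro mult_mono)
          show "phase_norm \<gamma> (?e s) \<le> E * (N * exp (- \<delta> * (real s - real \<tau>)))"
            using phase_norm_spike f[of s] by (rule order_trans)
          have "0 \<le> real n - real (Suc s)" using s by auto
          then have "\<mu> * (real n - real (Suc s)) \<le> \<nu> * (real n - real (Suc s))"
            using \<mu>(2) by (rule mult_right_mono[rotated])
          then show "exp (- \<nu> * (real n - real (Suc s))) \<le> exp (- \<mu> * (real n - real (Suc s)))"
            by simp
        qed (use K phase_norm_nonneg[OF e] in auto)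
        also have "\<dots> = K * E * N * (exp (- \<mu> * (real n - real (Suc s))) * exp (- \<delta> * (real s - real \<tau>)))"
          by simp
        also have "\<dots> \<le> K * E * N * (exp \<mu> * exp (- \<mu> * (real n - real \<tau>)) * q ^ (s - \<tau>))"
        proof (rule mult_left_mono)
          have "q ^ (s - \<tau>) = exp (- \<delta> / 2 * (real s - real \<tau>))"
            using s by (simp add: q_def of_nat_diff mult.commute flip: exp_of_nat_mult)
          moreover have "\<mu> * (real s - real \<tau>) \<le> \<delta> / 2 * (real s - real \<tau>)"
            using s \<mu>(3) by (intro mult_right_mono) auto
          \<comment> \<open>One half of \<open>\<delta> * (real s - real \<tau>)\<close> extends the
            decay at rate \<open>\<mu>\<close> from the interval after \<open>s\<close> back to
            \<open>\<tau>\<close>; the other half is left for \<open>q\<close>. The extra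
            \<open>\<mu>\<close> pays for \<open>Suc s\<close> in place of \<open>s\<close>.\<close>
          then have "- \<mu> * (real n - real (Suc s)) + - \<delta> * (real s - real \<tau>)
              \<le> \<mu> + - \<mu> * (real n - real \<tau>) + - \<delta> / 2 * (real s - real \<tau>)"
            by (simp add: field_simps)
          ultimately show "exp (- \<mu> * (real n - real (Suc s))) * exp (- \<delta> * (real s - real \<tau>))
              \<le> exp \<mu> * exp (- \<mu> * (real n - real \<tau>)) * q ^ (s - \<tau>)"
            by (simp only: exp_le_cancel_iff flip: exp_add)
        qed (use K \<open>0 \<le> E\<close> \<open>0 \<le> N\<close> in simp)
        finally show ?thesis by (simp add: mult.assoc)
      qed
      have "y (int n) = (\<Sum>s=\<tau>..<n. ?X s 0)"
        using fun_cong[OF L.variation_of_constants[of \<tau> y f n, OF _ y_step that], of 0]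
        by (simp add: prehistory_0 y_def)
      then have "norm (y (int n)) \<le>
          (\<Sum>s=\<tau>..<n. K * E * N * exp \<mu> * exp (- \<mu> * (real n - real \<tau>)) * q ^ (s - \<tau>))"
        by (simp only:) (rule sum_norm_le[OF summand])
      also have "\<dots> = K * E * N * exp \<mu> * exp (- \<mu> * (real n - real \<tau>)) * (\<Sum>s=\<tau>..<n. q ^ (s - \<tau>))"
        by (simp add: sum_distrib_left)
      also have "(\<Sum>s=\<tau>..<n. q ^ (s - \<tau>)) = (\<Sum>i<n - \<tau>. q ^ i)"
        using that by (intro sum.reindex_bij_witness[of _ "\<lambda>i. i + \<tau>" "\<lambda>s. s - \<tau>"]) auto
      also have "\<dots> = (1 - q ^ (n - \<tau>)) / (1 - q)"
        using q by (simp add: sum_gp_strict)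
      also have "K * E * N * exp \<mu> * exp (- \<mu> * (real n - real \<tau>)) * \<dots>
          \<le> K * E * N * exp \<mu> * exp (- \<mu> * (real n - real \<tau>)) * (1 / (1 - q))"
        using K q \<open>0 \<le> E\<close> \<open>0 \<le> N\<close> by (intro mult_left_mono divide_right_mono) auto
      also have "\<dots> = C * exp (- \<mu> * (real n - real \<tau>)) * N"
        by (simp add: C_def)
      finally show ?thesis .
    qed
    have "phase_norm \<delta> (prehistory x (int n)) \<le> (1 + C) * exp (- \<mu> * (real n - real \<tau>)) * N"
    proof (rule phase_norm_le)
      fix k
      show "norm (prehistory x (int n) k)
          \<le> (1 + C) * exp (- \<mu> * (real n - real \<tau>)) * N * exp (\<delta> * real k)"
      \<comment> \<open>Coordinates after \<open>\<tau>\<close> are values of \<open>y\<close> at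
        time \<open>n - k\<close>, and the lost factor \<open>exp (\<mu> * real k)\<close> is
        absorbed by the weight since \<open>\<mu> \<le> \<delta>\<close>. The other coordinates are
        initial history, already estimated by \<open>h\<close>. The constant \<open>1 + C\<close>
        dominates both bounds.\<close>
      proof (cases "int n - int k > int \<tau>")
        case True
        then have k: "int n - int k = int (n - k)" "\<tau> \<le> n - k" "real (n - k) = real n - real k"
          by auto
        have "prehistory x (int n) k = y (int (n - k))"
          using True by (simp add: prehistory_def y_def flip: k(1))
        then have "norm (prehistory x (int n) k) \<le> C * N * exp (- \<mu> * (real n - real k - real \<tau>))"
          using y_bound[OF k(2)] unfolding k(3) by (simp only: mult_ac)
        also have "\<dots> \<le> (1 + C) * N * exp (- \<mu> * (real n - real \<tau>) + \<delta> * real k)"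
        proof (intro mult_mono)
          have "\<mu> * real k \<le> \<delta> * real k" using \<mu>(4) by (simp add: mult_right_mono)
          then show "exp (- \<mu> * (real n - real k - real \<tau>)) \<le> exp (- \<mu> * (real n - real \<tau>) + \<delta> * real k)"
            by (simp add: algebra_simps)
        qed (use \<open>0 \<le> C\<close> \<open>0 \<le> N\<close> in auto)
        also have "\<dots> = (1 + C) * exp (- \<mu> * (real n - real \<tau>)) * N * exp (\<delta> * real k)"
          by (simp only: exp_add mult_ac)
        finally show ?thesis .
      next
        case False
        have "norm (prehistory x (int n) k) \<le> N * exp (- \<delta> * (real n - real \<tau>)) * exp (\<delta> * real k)"
          using h[of n k] False by (simp add: h_def prehistory_def)
        also have "\<dots> \<le> (1 + C) * N * exp (- \<mu> * (real n - real \<tau>)) * exp (\<delta> * real k)"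
        proof (intro mult_mono)
          show "N \<le> (1 + C) * N" using \<open>0 \<le> C\<close> \<open>0 \<le> N\<close> by (simp add: algebra_simps)
          have "\<mu> * (real n - real \<tau>) \<le> \<delta> * (real n - real \<tau>)"
            using \<mu>(4) \<open>\<tau> \<le> n\<close> by (intro mult_right_mono) auto
          then show "exp (- \<delta> * (real n - real \<tau>)) \<le> exp (- \<mu> * (real n - real \<tau>))" by simp
        qed (use \<open>0 \<le> C\<close> \<open>0 \<le> N\<close> in auto)
        also have "\<dots> = (1 + C) * exp (- \<mu> * (real n - real \<tau>)) * N * exp (\<delta> * real k)"
          by simp
        finally show ?thesis .
      qed
    qed
    then show ?thesis by (simp add: x_def N_def)
  qed
  show ?thesis
    unfolding stable_with_rate_def \<mu>_def[symmetric]
    using bound \<open>0 \<le> C\<close> by (intro exI[of _ "1 + C"]) auto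
qed

text \<open>Taking the minimum with \<open>\<delta> / 2\<close> keeps the rate 0 and keeps positive
  rates positive, so the quantitative transfer yields both notions of stability.\<close>

lemma stability_transfer:
  assumes "fading_system \<delta> M" and "fading_system \<gamma> L"
    and "\<And>n \<phi>. (\<And>k. n \<le> k \<Longrightarrow> \<phi> k = 0) \<Longrightarrow> M n \<phi> = L n \<phi>"
  shows "uniformly_stable \<gamma> L \<Longrightarrow> uniformly_stable \<delta> M"
    and "uniformly_exponentially_stable \<gamma> L \<Longrightarrow> uniformly_exponentially_stable \<delta> M"
proof -
  have pos: "0 < \<delta>" using assms(1) by (simp add: fading_system_def)
  note transfer = stable_with_rate_transfer[OF assms]
  show "uniformly_stable \<delta> M" if "uniformly_stable \<gamma> L"
    using transfer[of 0] that pos by (simp add: uniformly_stable_iff_rate)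
  show "uniformly_exponentially_stable \<delta> M" if L: "uniformly_exponentially_stable \<gamma> L"
  proof -
    obtain \<nu> where "0 < \<nu>" "stable_with_rate \<nu> \<gamma> L"
      using L unfolding uniformly_exponentially_stable_iff_rate by blast
    then have "stable_with_rate (min \<nu> (\<delta> / 2)) \<delta> M" "0 < min \<nu> (\<delta> / 2)"
      using transfer[of \<nu>] pos by auto
    then show ?thesis unfolding uniformly_exponentially_stable_iff_rate by blast
  qed
qed

section \<open>Bounded operators and subdiagonal parts as instances of the abstract class\<close>

text \<open>A vector whose coordinates with index above \<open>m\<close> vanish is fixed by
  \<open>proj {..m}\<close>, so on such vectors the norm of the composition bounds
  \<open>L n\<close> itself.\<close>

lemma fading_system_bounded_operators:
  assumes "0 < \<gamma>" and L: "\<And>n. L n \<in> bounded_operators smul \<gamma>"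
    and "m \<le> 0" and bdd: "bdd_above (range (\<lambda>n. operator_norm \<gamma> (L n \<circ> proj {..m})))"
  shows "fading_system \<gamma> L"
proof
  show bounded: "\<exists>C. \<forall>\<phi>\<in>phase_space \<gamma>. norm (L n \<phi>) \<le> C * phase_norm \<gamma> \<phi>" for n
    using L[of n] unfolding bounded_operators_def by blast
  obtain C where C: "\<And>n. operator_norm \<gamma> (L n \<circ> proj {..m}) \<le> C"
    using bdd unfolding bdd_above_def by blast
  have "norm (L n \<phi>) \<le> C * phase_norm \<gamma> \<phi>"
    if \<phi>: "\<phi> \<in> phase_space \<gamma>" and zero: "\<And>k. k < nat (- m) \<Longrightarrow> \<phi> k = 0" for n \<phi>
  proof -
    obtain B where B: "\<And>\<psi>. \<psi> \<in> phase_space \<gamma> \<Longrightarrow> norm (L n \<psi>) \<le> B * phase_norm \<gamma> \<psi>"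
      using bounded by blast
    \<comment> \<open>The supremum in \<open>operator_norm\<close> dominates its members only once
      they are known to be bounded above; the individual bound \<open>B\<close> of
      \<open>L n\<close> provides this.\<close>
    have quotient: "norm ((L n \<circ> proj {..m}) \<psi>) / phase_norm \<gamma> \<psi> \<le> \<bar>B\<bar>"
      if \<psi>: "\<psi> \<in> phase_space \<gamma>" for \<psi>
    proof -
      have space: "proj {..m} \<psi> \<in> phase_space \<gamma>"
        unfolding proj_def by (rule restrict_in_phase_space[OF \<psi>])
      have "norm (L n (proj {..m} \<psi>)) \<le> B * phase_norm \<gamma> (proj {..m} \<psi>)"
        by (rule B[OF space])
      also have "\<dots> \<le> \<bar>B\<bar> * phase_norm \<gamma> \<psi>"
        using phase_norm_restrict_le[OF \<psi>, of "\<lambda>k. - int k \<in> {..m}"] phase_norm_nonneg[OF space]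
        by (intro mult_mono) (auto simp: proj_def)
      finally show ?thesis
        using phase_norm_nonneg[OF \<psi>] by (cases "phase_norm \<gamma> \<psi> = 0") (auto simp: field_simps)
    qed
    have "proj {..m} \<phi> = \<phi>"
    proof
      fix k
      show "proj {..m} \<phi> k = \<phi> k" using zero[of k] \<open>m \<le> 0\<close> by (auto simp: proj_def)
    qed
    then have "norm (L n \<phi>) / phase_norm \<gamma> \<phi> = norm ((L n \<circ> proj {..m}) \<phi>) / phase_norm \<gamma> \<phi>"
      by simp
    also have "\<dots> \<le> operator_norm \<gamma> (L n \<circ> proj {..m})"
      unfolding operator_norm_def using quotient by (intro cSUP_upper \<phi> bdd_aboveI2)
    finally have le: "norm (L n \<phi>) / phase_norm \<gamma> \<phi> \<le> C" using C[of n] by linarith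
    show ?thesis
    proof (cases "phase_norm \<gamma> \<phi> = 0")
      \<comment> \<open>Division by zero yields 0, so the quotient gives no information here; the
        individual bound \<open>B\<close> forces \<open>L n \<phi>\<close> to be 0.\<close>
      case True
      then show ?thesis using B[OF \<phi>] by simp
    next
      case False
      then show ?thesis using le phase_norm_nonneg[OF \<phi>] by (simp add: field_simps)
    qed
  qed
  then show "\<exists>m C. \<forall>n. \<forall>\<phi>\<in>phase_space \<gamma>.
      (\<forall>k<m. \<phi> k = 0) \<longrightarrow> norm (L n \<phi>) \<le> C * phase_norm \<gamma> \<phi>"
    by blast
  show "L n (\<lambda>k. \<phi> k + \<psi> k) = L n \<phi> + L n \<psi>"
    if "\<phi> \<in> phase_space \<gamma>" "\<psi> \<in> phase_space \<gamma>" for n \<phi> \<psi>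
    using L[of n] that unfolding bounded_operators_def by blast
qed (fact \<open>0 < \<gamma>\<close>)

text \<open>At \<open>n = 0\<close> the truncation is the zero vector, which \<open>M 0\<close>
  sends to 0, in accordance with the separate convention in \<open>subdiagonal\<close>.\<close>

lemma (in fading_system) subdiagonal_eq: "subdiagonal M n \<phi> = M n (\<lambda>k. if k < n then \<phi> k else 0)"
proof -
  have "(- int k \<in> {- int n + 1..0}) = (k < n)" for k by auto
  then show ?thesis by (simp add: subdiagonal_def proj_def zero del: atLeastAtMost_iff)
qed

text \<open>This turns equality of subdiagonal parts into the agreement hypothesis of the transfer
  lemmas.\<close>

lemma (in fading_system) subdiagonal_agree:
  assumes "\<And>k. n \<le> k \<Longrightarrow> \<phi> k = 0"
  shows "subdiagonal M n \<phi> = M n \<phi>"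
proof -
  have "(\<lambda>k. if k < n then \<phi> k else 0) = \<phi>" using assms by (auto simp: fun_eq_iff)
  then show ?thesis by (simp add: subdiagonal_eq)
qed

text \<open>Truncation does not enlarge the norm and preserves vanishing newest coordinates, so both
  bounds are inherited. The absolute value of \<open>C\<close> keeps the factor monotone when the
  norm of the truncation is replaced by that of \<open>\<phi>\<close>.\<close>

lemma (in fading_system) fading_system_subdiagonal: "fading_system \<gamma> (subdiagonal M)"
proof
  have norm_le: "norm (subdiagonal M n \<phi>) \<le> \<bar>C\<bar> * phase_norm \<gamma> \<phi>"
    if \<phi>: "\<phi> \<in> phase_space \<gamma>"
      and C: "norm (M n (\<lambda>k. if k < n then \<phi> k else 0))
        \<le> C * phase_norm \<gamma> (\<lambda>k. if k < n then \<phi> k else 0)" for n \<phi> C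
  proof -
    have "C * phase_norm \<gamma> (\<lambda>k. if k < n then \<phi> k else 0) \<le> \<bar>C\<bar> * phase_norm \<gamma> \<phi>"
      using phase_norm_restrict_le[OF \<phi>] phase_norm_nonneg[OF truncate_in_phase_space]
      by (intro mult_mono) auto
    then show ?thesis using C by (simp add: subdiagonal_eq)
  qed
  show "\<exists>C. \<forall>\<phi>\<in>phase_space \<gamma>. norm (subdiagonal M n \<phi>) \<le> C * phase_norm \<gamma> \<phi>" for n
    using bounded[of n] norm_le truncate_in_phase_space by blast
  obtain m C where "\<And>n \<phi>. \<phi> \<in> phase_space \<gamma> \<Longrightarrow> \<forall>k<m. \<phi> k = 0 \<Longrightarrow>
      norm (M n \<phi>) \<le> C * phase_norm \<gamma> \<phi>"
    using tail_bounded by blast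
  then have "norm (subdiagonal M n \<phi>) \<le> \<bar>C\<bar> * phase_norm \<gamma> \<phi>"
    if "\<phi> \<in> phase_space \<gamma>" "\<forall>k<m. \<phi> k = 0" for n \<phi>
    using that by (intro norm_le truncate_in_phase_space) (simp_all add: truncate_in_phase_space)
  then show "\<exists>m C. \<forall>n. \<forall>\<phi>\<in>phase_space \<gamma>.
      (\<forall>k<m. \<phi> k = 0) \<longrightarrow> norm (subdiagonal M n \<phi>) \<le> C * phase_norm \<gamma> \<phi>"
    by blast
  show "subdiagonal M n (\<lambda>k. \<phi> k + \<psi> k) = subdiagonal M n \<phi> + subdiagonal M n \<psi>" for n \<phi> \<psi>
  proof -
    have "(\<lambda>k. if k < n then \<phi> k + \<psi> k else 0)
        = (\<lambda>k. (if k < n then \<phi> k else 0) + (if k < n then \<psi> k else 0))"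
      by auto
    then show ?thesis
      by (simp add: subdiagonal_eq add truncate_in_phase_space)
  qed
qed (rule pos)

theorem theorem5p6:
  fixes smul :: "'k::real_normed_field \<Rightarrow> 'a::banach \<Rightarrow> 'a"
    and \<gamma> :: real
    and L :: "nat \<Rightarrow> (nat \<Rightarrow> 'a) \<Rightarrow> 'a"
  assumes "banach_space_over smul"
    and "\<gamma> > 0"
    and "\<And>n. L n \<in> bounded_operators smul \<gamma>"
    and "\<exists>m::int\<le>0. bdd_above (range (\<lambda>n. operator_norm \<gamma> (L n \<circ> proj {..m})))"
  shows
    "((uniformly_exponentially_stable \<gamma> L
        \<longleftrightarrow> uniformly_exponentially_stable \<gamma> (subdiagonal L)) \<and>
      (uniformly_exponentially_stable \<gamma> (subdiagonal L)
        \<longleftrightarrow> (\<forall>\<delta>>0. \<forall>L'.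
              (\<forall>n. L' n \<in> bounded_operators smul \<delta>) \<and>
              (\<forall>n. subdiagonal L' n = subdiagonal L n) \<and>
              (\<exists>l::int\<le>0. bdd_above (range (\<lambda>n. operator_norm \<delta> (L' n \<circ> proj {..l}))))
              \<longrightarrow> uniformly_exponentially_stable \<delta> L'))) \<and>
     ((uniformly_stable \<gamma> L
        \<longleftrightarrow> uniformly_stable \<gamma> (subdiagonal L)) \<and>
      (uniformly_stable \<gamma> (subdiagonal L)
        \<longleftrightarrow> (\<forall>\<delta>>0. \<forall>L'.
              (\<forall>n. L' n \<in> bounded_operators smul \<delta>) \<and>
              (\<forall>n. subdiagonal L' n = subdiagonal L n) \<and>
              (\<exists>l::int\<le>0. bdd_above (range (\<lambda>n. operator_norm \<delta> (L' n \<circ> proj {..l}))))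
              \<longrightarrow> uniformly_stable \<delta> L')))"
proof -
  obtain m :: int where m: "m \<le> 0" "bdd_above (range (\<lambda>n. operator_norm \<gamma> (L n \<circ> proj {..m})))"
    using assms(4) by blast
  have L: "fading_system \<gamma> L"
    by (rule fading_system_bounded_operators[OF assms(2,3) m])
  have S: "fading_system \<gamma> (subdiagonal L)"
    by (rule fading_system.fading_system_subdiagonal[OF L])
  \<comment> \<open>\<open>P\<close> stands for either notion of stability; the argument uses only
    that \<open>P\<close> passes between systems that agree on vectors vanishing from coordinate
    \<open>n\<close> on, even with different weights.\<close>
  have equiv: "(P \<gamma> L \<longleftrightarrow> P \<gamma> (subdiagonal L)) \<and>
      (P \<gamma> (subdiagonal L) \<longleftrightarrow> (\<forall>\<delta>>0. \<forall>L'.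
        (\<forall>n. L' n \<in> bounded_operators smul \<delta>) \<and>
        (\<forall>n. subdiagonal L' n = subdiagonal L n) \<and>
        (\<exists>l::int\<le>0. bdd_above (range (\<lambda>n. operator_norm \<delta> (L' n \<circ> proj {..l}))))
        \<longrightarrow> P \<delta> L'))" (is "(?i \<longleftrightarrow> ?ii) \<and> (?ii \<longleftrightarrow> ?iii)")
    if transfer: "\<And>\<delta> \<gamma> M L. fading_system \<delta> M \<Longrightarrow> fading_system \<gamma> L \<Longrightarrow>
      (\<And>n \<phi>. (\<And>k. n \<le> k \<Longrightarrow> \<phi> k = 0) \<Longrightarrow> M n \<phi> = L n \<phi>) \<Longrightarrow> P \<gamma> L \<Longrightarrow> P \<delta> M"
    for P :: "real \<Rightarrow> (nat \<Rightarrow> (nat \<Rightarrow> 'a) \<Rightarrow> 'a) \<Rightarrow> bool"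
  proof -
    have i_ii: ?ii if ?i
    proof (rule transfer[OF S L _ that])
      show "subdiagonal L n \<phi> = L n \<phi>" if "\<And>k. n \<le> k \<Longrightarrow> \<phi> k = 0" for n \<phi>
        by (rule fading_system.subdiagonal_agree[OF L that])
    qed
    have ii_iii: ?iii if ?ii
    proof (intro allI impI, elim conjE exE)
      fix \<delta> :: real and L' l
      assume "0 < \<delta>" and L': "\<forall>n. L' n \<in> bounded_operators smul \<delta>"
        and sub: "\<forall>n. subdiagonal L' n = subdiagonal L n"
        and l: "l \<le> 0" "bdd_above (range (\<lambda>n. operator_norm \<delta> (L' n \<circ> proj {..l})))"
      have F: "fading_system \<delta> L'"
        by (rule fading_system_bounded_operators[OF \<open>0 < \<delta>\<close> L'[rule_format] l])
      show "P \<delta> L'"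
      proof (rule transfer[OF F S _ \<open>?ii\<close>])
        show "L' n \<phi> = subdiagonal L n \<phi>" if "\<And>k. n \<le> k \<Longrightarrow> \<phi> k = 0" for n \<phi>
          using fading_system.subdiagonal_agree[OF F that] sub by simp
      qed
    qed
    \<comment> \<open>\<open>L\<close> itself, with \<open>\<delta> = \<gamma>\<close>, is one of
      the admissible \<open>L'\<close>.\<close>
    have iii_i: ?i if ?iii
      using that[rule_format, of \<gamma> L] assms(2-4) by simp
    show ?thesis using i_ii ii_iii iii_i by argo
  qed
  show ?thesis
    by (rule conjI[OF equiv[of uniformly_exponentially_stable] equiv[of uniformly_stable]];
        erule (1) stability_transfer; assumption?; blast)
qed

end
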